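(* Let $C_3$ be the cyclic group of order $3$ and let $\lambda(C_3)$ be its superextension. Then $\mathrm{Aut}(\lambda(C_3))\cong\mathrm{Aut}(C_3)\cong C_2$, where $\mathrm{Aut}(\lambda(C_3))$ is the group of semigroup automorphisms of $\lambda(C_3)$.
   Context: $C_n$ denotes the cyclic group of order $n$. A family $\mathcal A$ of non-empty subsets of a set $X$ is an upfamily if $A\in\mathcal A$ and $A\subset B\subset X$ imply $B\in\mathcal A$. A family $\mathcal B$ of non-empty subsets of $X$ generates the upfamily $\langle \mathcal B\rangle=\{A\subset X:\exists B\in\mathcal B\ (B\subset A)\}$; we write $\langle B: B\in\mathcal B\rangle$ for it. An upfamily $\mathcal L$ is linked if $A\cap B\neq\emptyset$ for all $A,B\in\mathcal L$. The superextension $\lambda(X)$ is the set of all maximal (with respect to inclusion) linked upfamilies on $X$. For a semigroup $S$ (in particular, a group) with operation $*$, the set $\lambda(S)$ is a semigroup under the (known to be well-defined and associative) operation $$\mathcal A*\mathcal B=\Big\langle\bigcup_{a\in A}a*B_a : A\in\mathcal A,\ \{B_a\}_{a\in A}\subset\mathcal B\Big\rangle .$$ *)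

theory Defs
  imports "HOL-Algebra.Bij" "HOL-Algebra.Elementary_Groups"
begin

definition upfamily :: "'a set \<Rightarrow> 'a set set \<Rightarrow> bool"
  where "upfamily X \<A> \<longleftrightarrow>
    \<A> \<subseteq> Pow X - {{}} \<and> (\<forall>A\<in>\<A>. \<forall>B. A \<subseteq> B \<and> B \<subseteq> X \<longrightarrow> B \<in> \<A>)"

definition upfamily_generated :: "'a set \<Rightarrow> 'a set set \<Rightarrow> 'a set set"
  where "upfamily_generated X \<B> = {A. A \<subseteq> X \<and> (\<exists>B\<in>\<B>. B \<subseteq> A)}"

definition linked :: "'a set set \<Rightarrow> bool"
  where "linked \<L> \<longleftrightarrow> (\<forall>A\<in>\<L>. \<forall>B\<in>\<L>. A \<inter> B \<noteq> {})"

definition superextension :: "'a set \<Rightarrow> 'a set set set"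
  where "superextension X =
    {\<L>. upfamily X \<L> \<and> linked \<L> \<and>
         (\<forall>\<M>. upfamily X \<M> \<and> linked \<M> \<and> \<L> \<subseteq> \<M> \<longrightarrow> \<M> = \<L>)}"

definition upfamily_mult ::
    "('a, 'b) monoid_scheme \<Rightarrow> 'a set set \<Rightarrow> 'a set set \<Rightarrow> 'a set set"
  where "upfamily_mult G \<A> \<B> =
    upfamily_generated (carrier G)
      {\<Union>a\<in>A. a <#\<^bsub>G\<^esub> B a | A B. A \<in> \<A> \<and> (\<forall>a\<in>A. B a \<in> \<B>)}"

text \<open>
  The library has no record for semigroups, so the superextension is packaged as a monoid record.
  Its unit field is the principal ultrafilter at the unit of the base group; neither
  \<^const>\<open>hom\<close> nor \<^const>\<open>AutoGroup\<close> inspects that field, so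
  \<^term>\<open>AutoGroup (superextension_semigroup G)\<close> consists of all multiplicative bijections.
\<close>

definition superextension_semigroup :: "('a, 'b) monoid_scheme \<Rightarrow> 'a set set monoid"
  where "superextension_semigroup G =
    \<lparr>carrier = superextension (carrier G),
     monoid.mult = upfamily_mult G,
     one = upfamily_generated (carrier G) {{\<one>\<^bsub>G\<^esub>}}\<rparr>"

end

(* A maximal linked upfamily on a three-element set X that contains a singleton {x} consists of all
   sets containing x; one without singletons is the family T of all subsets with at least two
   elements. So the superextension of C3 is a copy of C3 with one further element T, and T is a zero,
   since translates and unions of sets with at least two elements have at least two elements.
   An automorphism fixes the zero, hence is determined by its restriction to C3. *)
theory Submission
  imports Defs
begin

section \<open>Automorphisms of a structure with an adjoined zero\<close>

lemma carrier_AutoGroup [simp]: "carrier (AutoGroup G) = auto G"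
  by (simp add: AutoGroup_def)

lemma mult_AutoGroup:
  "\<lbrakk>f \<in> auto G; g \<in> auto G\<rbrakk> \<Longrightarrow> f \<otimes>\<^bsub>AutoGroup G\<^esub> g = compose (carrier G) f g"
  by (simp add: AutoGroup_def BijGroup_def auto_def)

lemma autoI:
  assumes "f \<in> extensional (carrier G)" "bij_betw f (carrier G) (carrier G)"
    and "\<And>x y. \<lbrakk>x \<in> carrier G; y \<in> carrier G\<rbrakk> \<Longrightarrow> f (x \<otimes>\<^bsub>G\<^esub> y) = f x \<otimes>\<^bsub>G\<^esub> f y"
  shows "f \<in> auto G"
  using assms by (auto simp: auto_def Bij_def hom_def dest: bij_betwE)

lemma autoD:
  assumes "f \<in> auto G"
  shows "f \<in> extensional (carrier G)" "bij_betw f (carrier G) (carrier G)"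
    and "\<And>x y. \<lbrakk>x \<in> carrier G; y \<in> carrier G\<rbrakk> \<Longrightarrow> f (x \<otimes>\<^bsub>G\<^esub> y) = f x \<otimes>\<^bsub>G\<^esub> f y"
  using assms by (auto simp: auto_def Bij_def hom_def)

text \<open>Surjectivity provides some \<open>s\<close> with \<open>f s = z\<close>. Applying
  \<open>f\<close> to \<open>z = z s\<close> gives \<open>f z = f z \<otimes> z\<close>, and the
  right-hand side is absorbed by \<open>z\<close>.\<close>

lemma auto_fixes_zero:
  assumes "f \<in> auto S" "z \<in> carrier S"
    and absorb: "\<And>s. s \<in> carrier S \<Longrightarrow> z \<otimes>\<^bsub>S\<^esub> s = z" "\<And>s. s \<in> carrier S \<Longrightarrow> s \<otimes>\<^bsub>S\<^esub> z = z"
  shows "f z = z"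
proof -
  note f = autoD[OF assms(1)]
  obtain s where s: "s \<in> carrier S" "f s = z"
    using f(2) assms(2) by (metis bij_betw_iff_bijections)
  have "f z = f z \<otimes>\<^bsub>S\<^esub> f s"
    using f(3)[of z s] s absorb(1)[of s] assms(2) by simp
  also have "\<dots> = z"
    using absorb(2) s f(2) assms(2) by (metis bij_betwE)
  finally show ?thesis .
qed

text \<open>This is the abstract form of the reduction: \<open>e\<close> embeds \<open>G\<close> as
  the complement of the zero \<open>z\<close>. Since automorphisms fix \<open>z\<close>, they
  permute the copy of \<open>G\<close>, so they restrict to it; conversely an automorphism of
  \<open>G\<close> extends by sending \<open>z\<close> to itself.\<close>

lemma (in monoid) AutoGroup_adjoin_zero:
  fixes S :: "('c, 'd) monoid_scheme"
  assumes carr: "carrier S = insert z (e ` carrier G)" and z: "z \<notin> e ` carrier G"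
    and inj: "inj_on e (carrier G)"
    and mult: "\<And>x y. \<lbrakk>x \<in> carrier G; y \<in> carrier G\<rbrakk> \<Longrightarrow> e x \<otimes>\<^bsub>S\<^esub> e y = e (x \<otimes> y)"
    and absorb: "\<And>s. s \<in> carrier S \<Longrightarrow> z \<otimes>\<^bsub>S\<^esub> s = z" "\<And>s. s \<in> carrier S \<Longrightarrow> s \<otimes>\<^bsub>S\<^esub> z = z"
  shows "AutoGroup S \<cong> AutoGroup G"
proof -
  \<comment> \<open>Restriction of \<open>f\<close> to the copy of \<open>G\<close>, pulled back
    along \<open>e\<close>. The bounded lambda makes the value \<open>undefined\<close> outside
    \<open>carrier G\<close>, as elements of \<open>auto G\<close> must be extensional.\<close>
  define \<Psi> where "\<Psi> f = (\<lambda>x\<in>carrier G. inv_into (carrier G) e (f (e x)))" for f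
  have z_in: "z \<in> carrier S" and e_in: "\<And>x. x \<in> carrier G \<Longrightarrow> e x \<in> carrier S"
    by (auto simp: carr)
  have e_cancel: "e x = e y \<Longrightarrow> x = y" if "x \<in> carrier G" "y \<in> carrier G" for x y
    using inj that by (simp add: inj_on_def)
  have fz: "f z = z" if "f \<in> auto S" for f
    using auto_fixes_zero[OF that z_in absorb] .
  have fe: "f (e x) \<in> e ` carrier G" if f: "f \<in> auto S" and x: "x \<in> carrier G" for f x
  proof -
    \<comment> \<open>Injectivity of \<open>f\<close> applies because \<open>e x \<noteq> z\<close>;
      together with \<open>f z = z\<close> it keeps \<open>f (e x)\<close> inside the copy of
      \<open>G\<close>.\<close>
    have "f (e x) \<noteq> f z"
      using autoD(2)[OF f] z x e_in z_in by (metis bij_betw_iff_bijections imageI)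
    then show ?thesis
      using autoD(2)[OF f] e_in[OF x] fz[OF f] carr by (auto dest: bij_betwE)
  qed
  \<comment> \<open>The intertwining relation \<open>e (\<Psi> f x) = f (e x)\<close> characterises
    \<open>\<Psi> f\<close>. Below, identities about \<open>\<Psi>\<close> are proved by applying
    \<open>e\<close>, rewriting with this relation and cancelling \<open>e\<close>.\<close>
  have \<Psi>: "\<Psi> f x \<in> carrier G" "e (\<Psi> f x) = f (e x)"
    if "f \<in> auto S" "x \<in> carrier G" for f x
    using fe[OF that] that(2) by (auto simp: \<Psi>_def inv_into_into f_inv_into_f)
  have \<Psi>_auto: "\<Psi> f \<in> auto G" if f: "f \<in> auto S" for f
  proof (rule autoI)
    show "\<Psi> f \<in> extensional (carrier G)" by (simp add: \<Psi>_def)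
    show "\<Psi> f (x \<otimes> y) = \<Psi> f x \<otimes> \<Psi> f y" if "x \<in> carrier G" "y \<in> carrier G" for x y
    proof (rule e_cancel)
      show "e (\<Psi> f (x \<otimes> y)) = e (\<Psi> f x \<otimes> \<Psi> f y)"
        using that f by (simp add: \<Psi> mult[symmetric] autoD(3)[OF f] e_in)
    qed (use that f in \<open>auto simp: \<Psi>\<close>)
    have "inj_on (\<Psi> f) (carrier G)"
    proof (rule inj_onI)
      fix x y assume xy: "x \<in> carrier G" "y \<in> carrier G" "\<Psi> f x = \<Psi> f y"
      then have "f (e x) = f (e y)" using \<Psi>(2)[OF f] by metis
      then have "e x = e y"
        using autoD(2)[OF f] xy e_in by (auto simp: bij_betw_def inj_on_def)
      then show "x = y" using e_cancel xy by blast
    qed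
    moreover have "y \<in> \<Psi> f ` carrier G" if y: "y \<in> carrier G" for y
    proof -
      obtain s where s: "s \<in> carrier S" "f s = e y"
        using autoD(2)[OF f] e_in[OF y] by (metis bij_betw_iff_bijections)
      then have "s \<noteq> z" using fz[OF f] z y by force
      then obtain x where x: "x \<in> carrier G" "s = e x" using s carr by blast
      then have "\<Psi> f x = y" using \<Psi>[OF f x(1)] s y e_cancel by metis
      then show ?thesis using x by blast
    qed
    ultimately show "bij_betw (\<Psi> f) (carrier G) (carrier G)"
      using \<Psi>(1)[OF f] by (auto simp: bij_betw_def)
  qed
  have comp_auto: "compose (carrier S) f g \<in> auto S" if f: "f \<in> auto S" and g: "g \<in> auto S" for f g
  proof (rule autoI)
    show "bij_betw (compose (carrier S) f g) (carrier S) (carrier S)"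
      using autoD(2)[OF f] autoD(2)[OF g] by (rule bij_betw_compose[rotated])
    \<comment> \<open>Closure of \<open>S\<close> is read off from the multiplication rules. It is
      required because \<open>compose\<close> is restricted to \<open>carrier S\<close> and gets
      evaluated at a product.\<close>
    have S: "x \<otimes>\<^bsub>S\<^esub> y \<in> carrier S" if "x \<in> carrier S" "y \<in> carrier S" for x y
      using that absorb mult by (auto simp: carr)
    show "compose (carrier S) f g (x \<otimes>\<^bsub>S\<^esub> y) = compose (carrier S) f g x \<otimes>\<^bsub>S\<^esub> compose (carrier S) f g y"
      if "x \<in> carrier S" "y \<in> carrier S" for x y
      using that S autoD(3)[OF f] autoD(3)[OF g] bij_betwE[OF autoD(2)[OF g]]
      by (simp add: compose_def)
  qed simp
  have "\<Psi> \<in> hom (AutoGroup S) (AutoGroup G)"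
  proof (rule homI)
    fix f g assume "f \<in> carrier (AutoGroup S)" "g \<in> carrier (AutoGroup S)"
    then have f: "f \<in> auto S" and g: "g \<in> auto S" by simp_all
    have "\<Psi> (compose (carrier S) f g) x = compose (carrier G) (\<Psi> f) (\<Psi> g) x"
      if x: "x \<in> carrier G" for x
    \<comment> \<open>After applying \<open>e\<close>, both sides become
      \<open>f (g (e x))\<close>.\<close>
    proof (rule e_cancel)
      show "e (\<Psi> (compose (carrier S) f g) x) = e (compose (carrier G) (\<Psi> f) (\<Psi> g) x)"
        using x e_in[OF x] by (simp add: \<Psi> f g comp_auto compose_eq)
    qed (use x in \<open>simp_all add: \<Psi> f g comp_auto compose_eq\<close>)
    then have "\<Psi> (compose (carrier S) f g) = compose (carrier G) (\<Psi> f) (\<Psi> g)"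
      by (intro extensionalityI[of _ "carrier G"]) (simp_all add: \<Psi>_def)
    then show "\<Psi> (f \<otimes>\<^bsub>AutoGroup S\<^esub> g) = \<Psi> f \<otimes>\<^bsub>AutoGroup G\<^esub> \<Psi> g"
      by (simp add: mult_AutoGroup f g \<Psi>_auto)
  qed (simp add: \<Psi>_auto)
  moreover have "inj_on \<Psi> (auto S)"
  proof (rule inj_onI)
    fix f g assume f: "f \<in> auto S" and g: "g \<in> auto S" and eq: "\<Psi> f = \<Psi> g"
    \<comment> \<open>Both maps fix \<open>z\<close>, and on the copy of \<open>G\<close> they are
      recovered from the common value of \<open>\<Psi>\<close>.\<close>
    have "f s = g s" if "s \<in> carrier S" for s
      using that \<Psi>(2)[OF f] \<Psi>(2)[OF g] eq fz[OF f] fz[OF g] by (auto simp: carr)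
    then show "f = g"
      by (intro extensionalityI[of _ "carrier S"]) (simp_all add: autoD(1) f g)
  qed
  moreover have "h \<in> \<Psi> ` auto S" if h: "h \<in> auto G" for h
  proof -
    \<comment> \<open>The preimage of \<open>h\<close> under \<open>\<Psi>\<close>: transport
      \<open>h\<close> to the copy of \<open>G\<close> and fix the zero.\<close>
    define f where "f = (\<lambda>s\<in>carrier S. if s = z then z else e (h (inv_into (carrier G) e s)))"
    have hG: "h x \<in> carrier G" if "x \<in> carrier G" for x
      using autoD(2)[OF h] that by (blast dest: bij_betwE)
    have f_z: "f z = z" by (simp add: f_def z_in)
    have f_e: "f (e x) = e (h x)" if "x \<in> carrier G" for x
      using that z inj by (auto simp: f_def e_in inv_into_f_f)
    have "f ` carrier S = insert z (e ` h ` carrier G)"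
      using f_z f_e by (auto simp: carr image_image)
    also have "h ` carrier G = carrier G" using autoD(2)[OF h] by (simp add: bij_betw_def)
    finally have surj: "f ` carrier S = carrier S" by (simp add: carr)
    have f_e_z: "f (e x) \<noteq> z" if "x \<in> carrier G" for x
      using f_e[OF that] hG[OF that] z by (metis imageI)
    have f_e_inj: "x = y" if x: "x \<in> carrier G" and y: "y \<in> carrier G" and eq: "f (e x) = f (e y)" for x y
    proof -
      have "h x = h y"
        using eq f_e[OF x] f_e[OF y] e_cancel[OF hG[OF x] hG[OF y]] by simp
      then show ?thesis by (rule inj_onD[OF bij_betw_imp_inj_on[OF autoD(2)[OF h]] _ x y])
    qed
    have "inj_on f (carrier S)"
    proof (rule inj_onI)
      fix s t assume st: "s \<in> carrier S" "t \<in> carrier S" "f s = f t"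
      show "s = t"
      proof (cases "s = z \<or> t = z")
        case True
        then show ?thesis using st f_z f_e_z by (force simp: carr)
      next
        case False
        then obtain x y where "x \<in> carrier G" "s = e x" "y \<in> carrier G" "t = e y"
          using st(1,2) carr by blast
        then show ?thesis using st(3) f_e_inj by blast
      qed
    qed
    then have bij: "bij_betw f (carrier S) (carrier S)" using surj by (simp add: bij_betw_def)
    have f_in: "f s \<in> carrier S" if "s \<in> carrier S" for s using surj that by blast
    have f: "f \<in> auto S"
    proof (rule autoI[OF _ bij])
      show "f \<in> extensional (carrier S)" by (simp add: f_def)
      fix s t assume st: "s \<in> carrier S" "t \<in> carrier S"
      show "f (s \<otimes>\<^bsub>S\<^esub> t) = f s \<otimes>\<^bsub>S\<^esub> f t"
      proof (cases "s = z \<or> t = z")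
        case True
        then show ?thesis using st f_in by (auto simp: absorb f_z)
      next
        case False
        then obtain x y where "x \<in> carrier G" "s = e x" "y \<in> carrier G" "t = e y"
          using st carr by blast
        then show ?thesis by (simp add: mult f_e hG autoD(3)[OF h])
      qed
    qed
    have "\<Psi> f x = h x" if "x \<in> carrier G" for x
      using \<Psi>[OF f that] f_e[OF that] e_cancel hG[OF that] by simp
    then have "\<Psi> f = h"
      by (intro extensionalityI[of _ "carrier G"]) (simp_all add: \<Psi>_def autoD(1)[OF h])
    then show ?thesis using f by blast
  qed
  ultimately show ?thesis
    using \<Psi>_auto by (intro is_isoI[of \<Psi>]) (auto simp: iso_def bij_betw_def)
qed

section \<open>Maximal linked upfamilies on a three-element set\<close>

lemma not_linked_if_disjoint:
  "\<lbrakk>linked \<M>; A \<in> \<M>; B \<in> \<M>; A \<inter> B = {}\<rbrakk> \<Longrightarrow> False"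
  by (auto simp: linked_def)

lemma upfamily_generated_singleton:
  "upfamily_generated X {{x}} = {A. A \<subseteq> X \<and> x \<in> A}"
  by (auto simp: upfamily_generated_def)

text \<open>Every member must meet \<open>{x}\<close>, so \<open>\<L>\<close> lies inside the
  principal family at \<open>x\<close>. That family is itself a linked upfamily, hence maximality of
  \<open>\<L>\<close> forces equality.\<close>

lemma superextension_singleton_mem:
  assumes "\<L> \<in> superextension X" "{x} \<in> \<L>"
  shows "\<L> = upfamily_generated X {{x}}"
proof -
  have sub: "\<L> \<subseteq> upfamily_generated X {{x}}"
  proof
    fix A assume A: "A \<in> \<L>"
    then have "{x} \<inter> A \<noteq> {}" "A \<subseteq> X"
      using assms by (auto simp: superextension_def upfamily_def linked_def)
    then show "A \<in> upfamily_generated X {{x}}" by (simp add: upfamily_generated_singleton)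
  qed
  have "upfamily X (upfamily_generated X {{x}})" "linked (upfamily_generated X {{x}})"
    by (auto simp: upfamily_def linked_def upfamily_generated_singleton)
  then show ?thesis using assms(1) sub unfolding superextension_def by blast
qed

text \<open>Maximality holds because a linked extension still has \<open>{x}\<close> as a member, so
  each of its members meets \<open>{x}\<close> and already belongs to the principal family.\<close>

lemma principal_in_superextension:
  assumes "x \<in> X"
  shows "upfamily_generated X {{x}} \<in> superextension X"
proof -
  have "\<M> = upfamily_generated X {{x}}"
    if M: "upfamily X \<M>" "linked \<M>" "upfamily_generated X {{x}} \<subseteq> \<M>" for \<M>
  proof -
    have "{x} \<in> \<M>" using M(3) assms by (auto simp: upfamily_generated_singleton)
    then have "x \<in> A" if "A \<in> \<M>" for A using not_linked_if_disjoint[OF M(2) _ that] by blast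
    moreover have "\<M> \<subseteq> Pow X" using M(1) by (auto simp: upfamily_def)
    ultimately show ?thesis using M(3) by (auto simp: upfamily_generated_singleton)
  qed
  moreover have "upfamily X (upfamily_generated X {{x}})" "linked (upfamily_generated X {{x}})"
    by (auto simp: upfamily_def linked_def upfamily_generated_singleton)
  ultimately show ?thesis unfolding superextension_def by blast
qed

lemma superextension_card_3:
  assumes X: "card X = 3"
  defines "T \<equiv> {A. A \<subseteq> X \<and> 2 \<le> card A}"
  shows "superextension X = insert T ((\<lambda>x. upfamily_generated X {{x}}) ` X)"
proof -
  have fin: "finite X" using X by (simp add: card_ge_0_finite)
  have up: "upfamily X T"
    by (auto simp: upfamily_def T_def intro: order_trans[OF _ card_mono[OF finite_subset[OF _ fin]]])
  have linked: "linked T"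
    unfolding linked_def
  proof (intro ballI notI)
    fix A B assume AB: "A \<in> T" "B \<in> T" "A \<inter> B = {}"
    \<comment> \<open>Two disjoint sets with at least two elements each would need four points of
      \<open>X\<close>.\<close>
    then have "card (A \<union> B) = card A + card B"
      by (intro card_Un_disjoint) (auto simp: T_def intro: finite_subset[OF _ fin])
    moreover have "card (A \<union> B) \<le> card X"
      using AB by (intro card_mono fin) (auto simp: T_def)
    ultimately show False using AB X by (auto simp: T_def)
  qed
  have singleton: "\<exists>x\<in>X. A = {x}" if "A \<subseteq> X" "A \<noteq> {}" "A \<notin> T" for A
  proof -
    have "finite A" using that(1) fin by (rule finite_subset)
    then have "card A \<noteq> 0" using that(2) by simp
    moreover have "card A < 2" using that(1,3) by (auto simp: T_def)
    ultimately have "card A = 1" by linarith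
    then show ?thesis using that(1) by (metis card_1_singletonE insert_subset)
  qed
  have max: "\<M> = T" if M: "upfamily X \<M>" "linked \<M>" "T \<subseteq> \<M>" for \<M>
  proof (rule ccontr)
    assume "\<M> \<noteq> T"
    then obtain A where A: "A \<in> \<M>" "A \<notin> T" using M(3) by blast
    then obtain x where x: "x \<in> X" "A = {x}"
      using M(1) singleton[of A] by (auto simp: upfamily_def)
    \<comment> \<open>The complement of a singleton has exactly two elements, so it lies in
      \<open>T\<close> and contradicts linkedness with \<open>{x}\<close>.\<close>
    have "X - {x} \<in> T" using x X by (auto simp: T_def card_Diff_singleton)
    then show False using M A x not_linked_if_disjoint[of \<M> "{x}" "X - {x}"] by blast
  qed
  have "T \<in> superextension X"
    using up linked max by (simp add: superextension_def)
  moreover have "\<L> \<in> insert T ((\<lambda>x. upfamily_generated X {{x}}) ` X)" if L: "\<L> \<in> superextension X" for \<L>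
  \<comment> \<open>If \<open>\<L> \<subseteq> T\<close>, maximality of \<open>\<L>\<close> gives
    \<open>\<L> = T\<close>; otherwise a member outside \<open>T\<close> is a singleton and
    \<open>\<L>\<close> is principal.\<close>
  proof (cases "\<L> \<subseteq> T")
    case True
    then show ?thesis using L up linked by (auto simp: superextension_def)
  next
    case False
    then obtain A where A: "A \<in> \<L>" "A \<notin> T" by blast
    then obtain x where "x \<in> X" "A = {x}"
      using L singleton[of A] by (auto simp: superextension_def upfamily_def)
    then show ?thesis using superextension_singleton_mem[OF L] A by blast
  qed
  moreover have "(\<lambda>x. upfamily_generated X {{x}}) ` X \<subseteq> superextension X"
    using principal_in_superextension by (rule image_subsetI)
  ultimately show ?thesis by (intro equalityI subsetI) auto
qed

section \<open>Products of principal families and of the family of sets with at least two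
  elements\<close>

lemma upfamily_mult_mem:
  "C \<in> upfamily_mult G \<A> \<B> \<longleftrightarrow>
    C \<subseteq> carrier G \<and> (\<exists>A\<in>\<A>. \<exists>B. (\<forall>a\<in>A. B a \<in> \<B>) \<and> (\<Union>a\<in>A. a <#\<^bsub>G\<^esub> B a) \<subseteq> C)"
  unfolding upfamily_mult_def upfamily_generated_def by blast

context group
begin

lemma upfamily_mult_principal:
  assumes x: "x \<in> carrier G" and y: "y \<in> carrier G"
  shows "upfamily_mult G (upfamily_generated (carrier G) {{x}}) (upfamily_generated (carrier G) {{y}})
    = upfamily_generated (carrier G) {{x \<otimes> y}}" (is "?L = ?R")
proof (intro Set.set_eqI iffI)
  fix C assume "C \<in> ?L"
  then show "C \<in> ?R"
    by (fastforce simp: upfamily_mult_mem upfamily_generated_singleton l_coset_def)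
next
  fix C assume "C \<in> ?R"
  then show "C \<in> ?L"
    using x y unfolding upfamily_mult_mem upfamily_generated_singleton
    by (intro conjI bexI[of _ "{x}"] exI[of _ "\<lambda>_. {y}"]) (auto simp: l_coset_def)
qed

lemma card_l_coset:
  assumes "a \<in> carrier G" "B \<subseteq> carrier G"
  shows "card (a <# B) = card B"
proof -
  have "a <# B = (\<lambda>x. a \<otimes> x) ` B" by (auto simp: l_coset_def)
  then show ?thesis
    using inj_on_subset[OF inj_on_cmult assms(2)] assms(1) by (simp add: card_image)
qed

lemma card_r_coset:
  assumes "a \<in> carrier G" "A \<subseteq> carrier G"
  shows "card (A #> a) = card A"
proof -
  have "A #> a = (\<lambda>x. x \<otimes> a) ` A" by (auto simp: r_coset_def)
  then show ?thesis
    using inj_on_subset[OF inj_on_multc assms(2)] assms(1) by (simp add: card_image)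
qed

lemma upfamily_mult_card_right:
  assumes fin: "finite (carrier G)" and A: "upfamily (carrier G) \<A>" "\<A> \<noteq> {}"
  defines "T \<equiv> {A. A \<subseteq> carrier G \<and> 2 \<le> card A}"
  shows "upfamily_mult G \<A> T = T"
proof (intro Set.set_eqI iffI)
  fix C assume "C \<in> upfamily_mult G \<A> T"
  then obtain A B where AB: "C \<subseteq> carrier G" "A \<in> \<A>" "\<forall>a\<in>A. B a \<in> T" "(\<Union>a\<in>A. a <# B a) \<subseteq> C"
    by (auto simp: upfamily_mult_mem)
  \<comment> \<open>A single translate \<open>a <# B a\<close> inside \<open>C\<close> suffices for
    the bound; it exists because members of an upfamily are non-empty.\<close>
  have "A \<noteq> {}" "A \<subseteq> carrier G" using A(1) AB(2) by (auto simp: upfamily_def)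
  then obtain a where a: "a \<in> A" "a \<in> carrier G" by blast
  then have "card (B a) = card (a <# B a)"
    using AB by (simp add: card_l_coset T_def)
  also have "\<dots> \<le> card C"
    using a AB by (intro card_mono finite_subset[OF _ fin]) auto
  finally show "C \<in> T" using AB a by (force simp: T_def)
next
  fix C assume C: "C \<in> T"
  obtain A where A': "A \<in> \<A>" "A \<subseteq> carrier G" using A by (auto simp: upfamily_def)
  \<comment> \<open>Choosing \<open>B a = inv a <# C\<close> turns every translate
    \<open>a <# B a\<close> into \<open>C\<close> itself, whatever \<open>A\<close> is.\<close>
  have "inv a <# C \<in> T" if "a \<in> A" for a
  proof -
    have "a \<in> carrier G" using that A' by blast
    then show ?thesis using C by (simp add: T_def card_l_coset l_coset_subset_G)
  qed
  moreover have "a <# (inv a <# C) = C" if "a \<in> A" for a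
  proof -
    have "a \<in> carrier G" using that A' by blast
    then show ?thesis using C by (simp add: T_def lcos_m_assoc lcos_mult_one)
  qed
  ultimately show "C \<in> upfamily_mult G \<A> T"
    using C A'(1) unfolding upfamily_mult_mem
    by (intro conjI bexI[of _ A] exI[of _ "\<lambda>a. inv a <# C"]) (auto simp: T_def)
qed

text \<open>Each \<open>B a\<close> contains \<open>b\<close>, so the union contains the right
  translate \<open>A #> b\<close>, which has as many elements as \<open>A\<close>. The remaining
  product of the family with itself is an instance of
  \<open>upfamily_mult_card_right\<close>.\<close>

lemma upfamily_mult_card_left:
  assumes fin: "finite (carrier G)" and b: "b \<in> carrier G"
  defines "T \<equiv> {A. A \<subseteq> carrier G \<and> 2 \<le> card A}"
  shows "upfamily_mult G T (upfamily_generated (carrier G) {{b}}) = T"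
proof (intro Set.set_eqI iffI)
  fix C assume "C \<in> upfamily_mult G T (upfamily_generated (carrier G) {{b}})"
  then obtain A B where AB: "C \<subseteq> carrier G" "A \<in> T" "\<forall>a\<in>A. b \<in> B a" "(\<Union>a\<in>A. a <# B a) \<subseteq> C"
    by (auto simp: upfamily_mult_mem upfamily_generated_singleton)
  have "card A = card (A #> b)"
    using AB b by (simp add: card_r_coset T_def)
  also have "\<dots> \<le> card C"
    using AB by (intro card_mono finite_subset[OF _ fin]) (fastforce simp: r_coset_def l_coset_def)+
  finally show "C \<in> T" using AB by (simp add: T_def)
next
  fix C assume C: "C \<in> T"
  \<comment> \<open>With this first factor and the constant choice \<open>{b}\<close>, the union of
    the translates is exactly \<open>C\<close>.\<close>
  have "C #> inv b \<in> T"
    using C b by (simp add: T_def card_r_coset r_coset_subset_G)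
  moreover have "(\<Union>a\<in>C #> inv b. a <# {b}) = (C #> inv b) #> b"
    by (auto simp: l_coset_def r_coset_def)
  moreover have "(C #> inv b) #> b = C"
    using C b by (simp add: T_def coset_mult_assoc)
  ultimately show "C \<in> upfamily_mult G T (upfamily_generated (carrier G) {{b}})"
    using C b unfolding upfamily_mult_mem upfamily_generated_singleton
    by (intro conjI bexI[of _ "C #> inv b"] exI[of _ "\<lambda>_. {b}"]) (auto simp: T_def)
qed

lemma AutoGroup_superextension_order_3:
  assumes "order G = 3"
  shows "AutoGroup (superextension_semigroup G) \<cong> AutoGroup G"
proof -
  let ?S = "superextension_semigroup G" and ?e = "\<lambda>x. upfamily_generated (carrier G) {{x}}"
  define T where "T = {A. A \<subseteq> carrier G \<and> 2 \<le> card A}"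
  have card: "card (carrier G) = 3" using assms by (simp add: order_def)
  then have fin: "finite (carrier G)" by (simp add: card_ge_0_finite)
  have S: "carrier ?S = insert T (?e ` carrier G)"
    using superextension_card_3[OF card] by (simp add: superextension_semigroup_def T_def)
  have mult: "mult ?S = upfamily_mult G" by (simp add: superextension_semigroup_def)
  have right: "upfamily_mult G s T = T" if "s \<in> carrier ?S" for s
  proof -
    have "upfamily (carrier G) s"
      using that by (simp add: superextension_semigroup_def superextension_def)
    \<comment> \<open>The whole group witnesses that \<open>s\<close> is non-empty, as
      \<open>upfamily_mult_card_right\<close> demands.\<close>
    moreover have "carrier G \<in> s"
      using that card unfolding S by (auto simp: T_def upfamily_generated_singleton)
    ultimately show ?thesis
      using upfamily_mult_card_right[OF fin] unfolding T_def by blast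
  qed
  \<comment> \<open>Singletons tell the families apart: they separate \<open>T\<close> from the
    principal families, and \<open>{x} \<in> ?e y\<close> forces \<open>x = y\<close>.\<close>
  have singleton: "{x} \<in> ?e x" "{x} \<notin> T" if "x \<in> carrier G" for x
    using that by (auto simp: T_def upfamily_generated_singleton)
  show ?thesis
  proof (rule AutoGroup_adjoin_zero)
    show "carrier ?S = insert T (?e ` carrier G)" by (rule S)
    show "T \<notin> ?e ` carrier G" using singleton by blast
    show "inj_on ?e (carrier G)"
    proof (rule inj_onI)
      fix x y assume "x \<in> carrier G" "?e x = ?e y"
      then have "{x} \<in> ?e y" using singleton by blast
      then show "x = y" by (simp add: upfamily_generated_singleton)
    qed
    show "?e x \<otimes>\<^bsub>?S\<^esub> ?e y = ?e (x \<otimes> y)" if "x \<in> carrier G" "y \<in> carrier G" for x y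
      using that by (simp add: mult upfamily_mult_principal)
    show "s \<otimes>\<^bsub>?S\<^esub> T = T" if "s \<in> carrier ?S" for s
      using right[OF that] by (simp add: mult)
    \<comment> \<open>For \<open>s = T\<close> this is the fact \<open>right\<close>; for principal
      \<open>s\<close> it is \<open>upfamily_mult_card_left\<close>.\<close>
    show "T \<otimes>\<^bsub>?S\<^esub> s = T" if s: "s \<in> carrier ?S" for s
      using s right[OF s] upfamily_mult_card_left[OF fin] unfolding S mult T_def by auto
  qed
qed

section \<open>Groups of order two and three and their automorphisms\<close>

lemma order_2_carrierE:
  assumes "order G = 2"
  obtains a where "a \<in> carrier G" "a \<noteq> \<one>" "carrier G = {\<one>, a}" "a \<otimes> a = \<one>"
proof -
  obtain x y where "carrier G = {x, y}" "x \<noteq> y"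
    using assms unfolding order_def card_2_iff by blast
  then obtain a where a: "a \<noteq> \<one>" "carrier G = {\<one>, a}"
    using one_closed by (metis insertE insert_commute singletonD)
  then have "a \<otimes> a \<in> {\<one>, a}" "a \<otimes> a \<noteq> a" using m_closed[of a a] l_cancel_one[of a a] by auto
  then show ?thesis using that[of a] a by blast
qed

text \<open>The multiplication table is forced, so matching the units and the two other elements is
  a homomorphism. This lets the automorphism group be identified by counting.\<close>

lemma iso_order_2:
  assumes "order G = 2" "group H" "order H = 2"
  shows "G \<cong> H"
proof -
  interpret H: group H by fact
  obtain a where a: "a \<in> carrier G" "a \<noteq> \<one>" "carrier G = {\<one>, a}" "a \<otimes> a = \<one>"
    using order_2_carrierE assms(1) by blast
  obtain b where b: "b \<in> carrier H" "b \<noteq> \<one>\<^bsub>H\<^esub>" "carrier H = {\<one>\<^bsub>H\<^esub>, b}" "b \<otimes>\<^bsub>H\<^esub> b = \<one>\<^bsub>H\<^esub>"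
    using H.order_2_carrierE assms(3) by blast
  let ?h = "\<lambda>x. if x = \<one> then \<one>\<^bsub>H\<^esub> else b"
  have "?h \<in> iso G H"
    using a b by (auto simp: iso_def hom_def bij_betw_def inj_on_def)
  then show ?thesis by (rule is_isoI)
qed

text \<open>Commutativity makes inversion multiplicative, and inversion is its own inverse. It
  supplies the nontrivial automorphism of the group of order three.\<close>

lemma inverse_in_auto:
  assumes "comm_group G"
  shows "(\<lambda>x\<in>carrier G. inv x) \<in> auto G"
proof (rule autoI)
  interpret comm_group G by fact
  show "bij_betw (\<lambda>x\<in>carrier G. inv x) (carrier G) (carrier G)"
    by (rule bij_betwI[where g = "m_inv G"]) auto
qed (use assms in \<open>auto simp: comm_group.inv_mult\<close>)

lemma order_3_carrierE:
  assumes "order G = 3"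
  obtains g where "g \<in> carrier G" "g \<noteq> \<one>" "inv g \<noteq> g" "carrier G = {\<one>, g, inv g}"
proof -
  have card: "card (carrier G) = 3" using assms by (simp add: order_def)
  have "finite (carrier G)" using card by (simp add: card_ge_0_finite)
  then have "card (carrier G - {\<one>}) = 2" using card by simp
  then obtain g h where gh: "g \<noteq> h" "carrier G - {\<one>} = {g, h}"
    unfolding card_2_iff by blast
  then have g: "g \<in> carrier G" "h \<in> carrier G" "g \<noteq> \<one>" "h \<noteq> \<one>" "carrier G = {\<one>, g, h}" by auto
  \<comment> \<open>By cancellation the product of the two nontrivial elements is neither of them,
    which leaves only the unit.\<close>
  have "g \<otimes> h \<noteq> g" "g \<otimes> h \<noteq> h" using g by auto
  then have "g \<otimes> h = \<one>" using m_closed[of g h] g by auto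
  then have "inv g = h" using g by (metis inv_equality inv_inv)
  then show ?thesis using that[of g] g gh by auto
qed

text \<open>An automorphism is determined by its value at \<open>g\<close>, since the other elements
  are the unit and \<open>inv g\<close>. Injectivity excludes the unit as this value, leaving
  \<open>g\<close> (the identity map) and \<open>inv g\<close> (inversion); the two maps differ
  because \<open>inv g \<noteq> g\<close>.\<close>

lemma card_auto_order_3:
  assumes "comm_group G" "order G = 3"
  shows "card (auto G) = 2"
proof -
  obtain g where g: "g \<in> carrier G" "g \<noteq> \<one>" "inv g \<noteq> g" "carrier G = {\<one>, g, inv g}"
    using order_3_carrierE assms(2) by blast
  let ?id = "\<lambda>x\<in>carrier G. x" and ?inv = "\<lambda>x\<in>carrier G. inv x"
  have "f = ?id \<or> f = ?inv" if f: "f \<in> auto G" for f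
  proof -
    have "f \<in> hom G G" using f by (simp add: auto_def)
    then interpret f: group_hom G G f by unfold_locales
    have "inj_on f (carrier G)" using autoD(2)[OF f] by (simp add: bij_betw_def)
    then have "f g \<noteq> \<one>" using g f.hom_one by (metis inj_onD one_closed)
    then have "f g = g \<or> f g = inv g" using f.hom_closed[OF g(1)] g(4) by blast
    then show ?thesis
    proof
      assume "f g = g"
      then have "f x = ?id x" if "x \<in> carrier G" for x
        using that g(1) f.hom_inv[of g] by (subst (asm) g(4)) auto
      then show ?thesis
        using extensionalityI[OF autoD(1)[OF f], of ?id] by simp
    next
      assume "f g = inv g"
      then have "f x = ?inv x" if "x \<in> carrier G" for x
        using that g(1) f.hom_inv[of g] by (subst (asm) g(4)) auto
      then show ?thesis
        using extensionalityI[OF autoD(1)[OF f], of ?inv] by simp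
    qed
  qed
  then have "auto G = {?id, ?inv}"
    using id_in_auto inverse_in_auto[OF assms(1)] by blast
  moreover have "?id \<noteq> ?inv" using g by (metis restrict_apply')
  ultimately show ?thesis by simp
qed

end

theorem mainTheorem5:
  fixes C3 :: "'a monoid" and C2 :: "'b monoid"
  assumes "group C3" and "cyclic_group C3" and "order C3 = 3"
    and "group C2" and "cyclic_group C2" and "order C2 = 2"
  shows "AutoGroup (superextension_semigroup C3) \<cong> AutoGroup C3 \<and> AutoGroup C3 \<cong> C2"
proof
  interpret C3: group C3 by fact
  show "AutoGroup (superextension_semigroup C3) \<cong> AutoGroup C3"
    using C3.AutoGroup_superextension_order_3 assms(3) .
  \<comment> \<open>Cyclicity enters through commutativity, which makes inversion an
    automorphism.\<close>
  have "order (AutoGroup C3) = 2"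
    using C3.card_auto_order_3[OF C3.cyclic_imp_abelian_group[OF assms(2)] assms(3)]
    by (simp add: order_def)
  then show "AutoGroup C3 \<cong> C2"
    using group.iso_order_2[OF C3.AutoGroup] assms(4,6) by blast
qed

end
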